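(* For every fixed integer $k\geqslant 3$, we have $D(n,k)=o(n^{k-1})$ as $n\to\infty$.
   Context: All graphs are finite, simple and undirected. For a graph $G$ and an integer $k\geq 1$, the $k$-configuration graph $\mathcal{R}_k(G)$ (token jumping model) is the graph whose vertices are the independent sets of $G$ of size exactly $k$, where two such independent sets $I,J$ are adjacent if and only if $|I\cap J|=k-1$ (i.e. $J$ is obtained from $I$ by removing one vertex and adding another vertex). $D(n,k)$ denotes the maximum, over all graphs $G$ on $n$ vertices, of the largest diameter of a connected component of $\mathcal{R}_k(G)$. *)

theory Defs
  imports "Graph_Theory.Graph_Theory" "HOL-Library.Landau_Symbols"
begin

text \<open>
  A finite simple undirected graph is a \<^locale>\<open>pair_graph\<close>: a finite, loopfree, symmetric
  digraph whose arcs are pairs of vertices, an undirected edge being a pair of opposite arcs.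
\<close>

definition independent_set :: "'a pair_pre_digraph \<Rightarrow> 'a set \<Rightarrow> bool" where
  "independent_set G I \<longleftrightarrow>
     I \<subseteq> pverts G \<and> (\<forall>u\<in>I. \<forall>v\<in>I. (u, v) \<notin> parcs G)"

text \<open>
  For \<open>k \<ge> 1\<close> this graph is loopfree, since \<open>I = J\<close> gives \<open>card (I \<inter> J) = k\<close>.
\<close>

definition configuration_graph :: "nat \<Rightarrow> 'a pair_pre_digraph \<Rightarrow> 'a set pair_pre_digraph" where
  "configuration_graph k G =
     (let V = {I. independent_set G I \<and> card I = k}
      in \<lparr> pverts = V, parcs = {(I, J). I \<in> V \<and> J \<in> V \<and> card (I \<inter> J) = k - 1} \<rparr>)"

text \<open>
  The value is meaningful only if \<open>v\<close> is reachable from \<open>u\<close>; below it is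
  used for connected graphs only.
\<close>

definition graph_dist :: "('a, 'b) pre_digraph \<Rightarrow> 'a \<Rightarrow> 'a \<Rightarrow> nat" where
  "graph_dist G u v = (LEAST m. \<exists>p. pre_digraph.awalk G u p v \<and> length p = m)"

definition graph_diameter :: "('a, 'b) pre_digraph \<Rightarrow> nat" where
  "graph_diameter G = Max {graph_dist G u v | u v. u \<in> verts G \<and> v \<in> verts G}"

text \<open>
  In a symmetric digraph the strongly connected components
  (\<^const>\<open>pre_digraph.sccs\<close>, nonempty induced subgraphs) are the connected components of the
  undirected graph. A graph without vertices has no component; its value is \<open>0\<close> by convention.
\<close>

definition max_component_diameter :: "('a, 'b) pre_digraph \<Rightarrow> nat" where
  "max_component_diameter G = Max (insert 0 (graph_diameter ` pre_digraph.sccs G))"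

text \<open>
  Since the quantity is invariant under isomorphism, the maximum over all graphs on \<open>n\<close> vertices
  is taken over the finitely many graphs with vertex set \<open>{..<n}\<close>.
\<close>

definition max_configuration_diameter :: "nat \<Rightarrow> nat \<Rightarrow> nat" where
  "max_configuration_diameter n k =
     Max {max_component_diameter (with_proj (configuration_graph k G)) | G :: nat pair_pre_digraph.
            pair_graph G \<and> pverts G = {..<n}}"

end

(* A geodesic in a component of the configuration graph, thinned to every third vertex, is a family
   F of independent k-sets no two of which have distance at most 2. Fix a set S of k - 3 vertices and
   look at the triples T with S + T in F. They are edge-disjoint triangles, and any further
   triangle xyz formed by their edges makes S + xyz independent (every pair of its elements lies in a
   member of F), hence a common neighbour of two members of F, which is impossible. So the triples
   satisfy the hypothesis of the Ruzsa-Szemeredi theorem and there are o(n^2) of them; summing over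
   the O(n^(k-3)) sets S bounds F.

   The Ruzsa-Szemeredi theorem is proved by an energy increment. If there are at least 10 d n^2
   triples, then for any bounded partition most triples (x, y, z) see the link of z occupying a
   positive proportion of the cells of x and y, while the edges of the pair graph inside
   the link of z form a matching, so they are far sparser than the cell pair. Splitting the
   cells along these links raises the energy by a constant, which can happen only boundedly often. *)
theory Submission
  imports Defs
begin

section \<open>The Ruzsa-Szemeredi theorem\<close>

definition cond_avg :: "'p set \<Rightarrow> ('p \<Rightarrow> 'c) \<Rightarrow> ('p \<Rightarrow> real) \<Rightarrow> 'p \<Rightarrow> real" where
  "cond_avg D C f p = (\<Sum>q | q \<in> D \<and> C q = C p. f q) / card {q \<in> D. C q = C p}"

text \<open>\<open>cond_avg\<close> is the conditional expectation of \<open>f\<close> under the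
  uniform measure on \<open>D\<close>, given the partition into colour classes, and
  \<open>energy\<close> is its squared norm. Without normalisation it ranges up to
  \<open>card D\<close> for a 0/1-valued \<open>f\<close>.\<close>

definition energy :: "'p set \<Rightarrow> ('p \<Rightarrow> 'c) \<Rightarrow> ('p \<Rightarrow> real) \<Rightarrow> real" where
  "energy D C f = (\<Sum>p\<in>D. (cond_avg D C f p)\<^sup>2)"

lemma cond_avg_cong: "C p = C q \<Longrightarrow> cond_avg D C f p = cond_avg D C f q"
  by (simp add: cond_avg_def)

lemma energy_nonneg: "0 \<le> energy D C f"
  by (simp add: energy_def sum_nonneg)

lemma sum_le_sum_if_fiberwise:
  fixes f g :: "'p \<Rightarrow> real"
  assumes "finite D"
    and "\<And>p. p \<in> D \<Longrightarrow> (\<Sum>q | q \<in> D \<and> C q = C p. f q) \<le> (\<Sum>q | q \<in> D \<and> C q = C p. g q)"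
  shows "sum f D \<le> sum g D"
proof -
  have "sum f D = (\<Sum>c\<in>C ` D. \<Sum>q | q \<in> D \<and> C q = c. f q)"
    by (rule sum.image_gen[OF assms(1)])
  also have "\<dots> \<le> (\<Sum>c\<in>C ` D. \<Sum>q | q \<in> D \<and> C q = c. g q)"
    by (rule sum_mono) (use assms(2) in auto)
  also have "\<dots> = sum g D"
    by (rule sum.image_gen[OF assms(1), symmetric])
  finally show ?thesis .
qed

text \<open>The defining property of conditional expectation. Choosing \<open>g\<close> as an
  average or as the indicator of a union of classes gives the later identities.\<close>

lemma sum_cond_avg_mult:
  assumes "finite D" and "\<And>p q. p \<in> D \<Longrightarrow> q \<in> D \<Longrightarrow> C p = C q \<Longrightarrow> g p = g q"
  shows "(\<Sum>p\<in>D. cond_avg D C f p * g p) = (\<Sum>p\<in>D. f p * g p)"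
proof -
  have "(\<Sum>q | q \<in> D \<and> C q = C p. cond_avg D C f q * g q) = (\<Sum>q | q \<in> D \<and> C q = C p. f q * g q)"
    if p: "p \<in> D" for p
  proof -
    let ?K = "{q \<in> D. C q = C p}"
    have "card ?K > 0"
      using p assms(1) by (auto simp: card_gt_0_iff)
    have "(\<Sum>q\<in>?K. cond_avg D C f q * g q) = (\<Sum>q\<in>?K. cond_avg D C f p * g p)"
    proof (rule sum.cong[OF refl])
      fix q assume "q \<in> ?K"
      then show "cond_avg D C f q * g q = cond_avg D C f p * g p"
        using cond_avg_cong[of C q p D f] assms(2)[of q p] p by simp
    qed
    also have "\<dots> = sum f ?K * g p"
      using \<open>card ?K > 0\<close> by (simp add: cond_avg_def)
    also have "\<dots> = (\<Sum>q\<in>?K. f q * g q)"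
      unfolding sum_distrib_right
    proof (rule sum.cong[OF refl])
      fix q assume "q \<in> ?K"
      then show "f q * g p = f q * g q"
        using assms(2)[of q p] p by simp
    qed
    finally show ?thesis .
  qed
  then show ?thesis
    by (intro antisym sum_le_sum_if_fiberwise[OF assms(1), where C=C]) auto
qed

text \<open>Averaging is an orthogonal projection: when the squared distance from \<open>f\<close>
  to its average is expanded, the cross term equals the energy itself.\<close>

lemma energy_le:
  assumes "finite D"
  shows "energy D C f \<le> (\<Sum>p\<in>D. (f p)\<^sup>2)"
proof -
  let ?a = "cond_avg D C f"
  have "(\<Sum>p\<in>D. ?a p * ?a p) = (\<Sum>p\<in>D. f p * ?a p)"
    by (rule sum_cond_avg_mult[OF assms]) (rule cond_avg_cong)
  moreover have "0 \<le> (\<Sum>p\<in>D. (f p - ?a p)\<^sup>2)"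
    by (simp add: sum_nonneg)
  moreover have "(\<Sum>p\<in>D. (f p - ?a p)\<^sup>2) = (\<Sum>p\<in>D. (f p)\<^sup>2) + (\<Sum>p\<in>D. (?a p)\<^sup>2) - 2 * (\<Sum>p\<in>D. f p * ?a p)"
    by (simp add: power2_diff sum.distrib sum_subtractf sum_distrib_left mult.assoc)
  ultimately show ?thesis
    by (simp add: energy_def power2_eq_square)
qed

text \<open>Pythagoras: the fine averages again average to the coarse ones, so the change between
  the two is orthogonal to the coarse averages.\<close>

lemma energy_refine:
  assumes "finite D" and refine: "\<And>p q. p \<in> D \<Longrightarrow> q \<in> D \<Longrightarrow> C' p = C' q \<Longrightarrow> C p = C q"
  shows "energy D C' f = energy D C f + (\<Sum>p\<in>D. (cond_avg D C f p - cond_avg D C' f p)\<^sup>2)"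
proof -
  let ?a = "cond_avg D C f" and ?b = "cond_avg D C' f"
  have "(\<Sum>p\<in>D. ?b p * ?a p) = (\<Sum>p\<in>D. f p * ?a p)"
    by (rule sum_cond_avg_mult[OF assms(1)]) (blast intro: cond_avg_cong refine)
  also have "\<dots> = (\<Sum>p\<in>D. ?a p * ?a p)"
    by (rule sum_cond_avg_mult[OF assms(1), symmetric]) (rule cond_avg_cong)
  finally have "(\<Sum>p\<in>D. ?b p * ?a p) = (\<Sum>p\<in>D. (?a p)\<^sup>2)"
    by (simp add: power2_eq_square)
  moreover have "(\<Sum>p\<in>D. (?a p - ?b p)\<^sup>2) =
    (\<Sum>p\<in>D. (?a p)\<^sup>2) + (\<Sum>p\<in>D. (?b p)\<^sup>2) - 2 * (\<Sum>p\<in>D. ?b p * ?a p)"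
    by (simp add: power2_diff sum.distrib sum_subtractf sum_distrib_left mult_ac)
  ultimately show ?thesis
    by (simp add: energy_def)
qed

text \<open>
  \<open>S\<close> need not respect the coarse colouring \<open>C\<close>, only the fine one; the gain is the variance of the
  fine averages around the coarse ones on \<open>S\<close>.
\<close>

lemma energy_increment:
  fixes \<delta> :: real
  assumes "finite D" and "0 \<le> \<delta>"
    and refine: "\<And>p q. p \<in> D \<Longrightarrow> q \<in> D \<Longrightarrow> C' p = C' q \<Longrightarrow> C p = C q"
    and "S \<subseteq> D" and sat: "\<And>p q. p \<in> S \<Longrightarrow> q \<in> D \<Longrightarrow> C' p = C' q \<Longrightarrow> q \<in> S"
    and dense: "\<And>p. p \<in> S \<Longrightarrow> \<delta> \<le> cond_avg D C f p"
    and sparse: "sum f S \<le> \<delta> / 2 * card S"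
  shows "energy D C f + \<delta>\<^sup>2 / 4 * card S \<le> energy D C' f"
proof -
  let ?a = "cond_avg D C f" and ?b = "cond_avg D C' f" and ?g = "\<lambda>p. if p \<in> S then 1 else 0 :: real"
  \<comment> \<open>\<open>S\<close> is a union of fine classes, so passing from \<open>f\<close> to
    the fine averages preserves the sum over \<open>S\<close>.\<close>
  have "(\<Sum>p\<in>D. ?b p * ?g p) = (\<Sum>p\<in>D. f p * ?g p)"
    by (rule sum_cond_avg_mult[OF assms(1)]) (use sat in auto)
  then have "sum ?b S = sum f S"
    using \<open>S \<subseteq> D\<close> \<open>finite D\<close> by (simp add: if_distrib sum.If_cases Int_absorb1 cong: if_cong)
  moreover have "(\<Sum>p\<in>S. \<delta>) \<le> sum ?a S"
    by (rule sum_mono) (rule dense)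
  ultimately have "\<delta> / 2 * card S \<le> (\<Sum>p\<in>S. ?a p - ?b p)"
    using sparse by (simp add: sum_subtractf algebra_simps)
  then have "\<delta>\<^sup>2 / 2 * card S \<le> \<delta> * (\<Sum>p\<in>S. ?a p - ?b p)"
    using mult_left_mono[OF _ \<open>0 \<le> \<delta>\<close>] by (fastforce simp: power2_eq_square)
  \<comment> \<open>The pointwise bound
    \<open>\<delta> * t - \<delta>\<^sup>2 / 4 \<le> t\<^sup>2\<close>, from a square around
    \<open>\<delta> / 2\<close>, does the work of Cauchy-Schwarz. The subtracted term costs half of
    the preceding lower bound.\<close>
  moreover have "\<delta> * (\<Sum>p\<in>S. ?a p - ?b p) - \<delta>\<^sup>2 / 4 * card S = (\<Sum>p\<in>S. \<delta> * (?a p - ?b p) - \<delta>\<^sup>2 / 4)"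
    by (simp add: sum_subtractf flip: sum_distrib_left)
  moreover have "\<dots> \<le> (\<Sum>p\<in>S. (?a p - ?b p)\<^sup>2)"
  proof (rule sum_mono)
    fix p
    have "0 \<le> (?a p - ?b p - \<delta> / 2)\<^sup>2" by simp
    then show "\<delta> * (?a p - ?b p) - \<delta>\<^sup>2 / 4 \<le> (?a p - ?b p)\<^sup>2"
      by (simp add: power2_eq_square algebra_simps)
  qed
  moreover have "\<dots> \<le> (\<Sum>p\<in>D. (?a p - ?b p)\<^sup>2)"
    by (rule sum_mono2) (use assms in auto)
  moreover have "energy D C' f = energy D C f + (\<Sum>p\<in>D. (?a p - ?b p)\<^sup>2)"
    by (rule energy_refine[OF assms(1) refine])
  ultimately show ?thesis by linarith
qed

text \<open>Low density is a property of whole classes, so on them \<open>f\<close> may be replaced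
  by its average, which is below \<delta>.\<close>

lemma sum_low_density_le:
  fixes \<delta> :: real
  assumes "finite D" and "0 \<le> \<delta>"
  shows "(\<Sum>p | p \<in> D \<and> cond_avg D C f p < \<delta>. f p) \<le> \<delta> * card D"
proof -
  let ?a = "cond_avg D C f" and ?g = "\<lambda>p. if cond_avg D C f p < \<delta> then 1 else 0 :: real"
  have "(\<Sum>p | p \<in> D \<and> ?a p < \<delta>. f p) = (\<Sum>p\<in>D. f p * ?g p)"
    using assms(1) by (simp add: if_distrib sum.If_cases Collect_conj_eq cong: if_cong)
  also have "\<dots> = (\<Sum>p\<in>D. ?a p * ?g p)"
    by (rule sum_cond_avg_mult[OF assms(1), symmetric]) (simp add: cond_avg_def)
  also have "\<dots> \<le> (\<Sum>p\<in>D. \<delta>)"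
    by (rule sum_mono) (use assms(2) in auto)
  finally show ?thesis
    by (simp add: mult.commute)
qed

section \<open>Energy increment for dense triple systems\<close>

text \<open>
  The triples are triangles of a tripartite graph whose edges are their two-element projections:
  no edge is used twice, and the graph has no other triangle.
\<close>

definition ruzsa_szemeredi :: "('a \<times> 'a \<times> 'a) set \<Rightarrow> bool" where
  "ruzsa_szemeredi M \<longleftrightarrow>
     (\<forall>x x' y z. (x, y, z) \<in> M \<longrightarrow> (x', y, z) \<in> M \<longrightarrow> x = x') \<and>
     (\<forall>x y y' z. (x, y, z) \<in> M \<longrightarrow> (x, y', z) \<in> M \<longrightarrow> y = y') \<and>
     (\<forall>x y z z'. (x, y, z) \<in> M \<longrightarrow> (x, y, z') \<in> M \<longrightarrow> z = z') \<and>
     (\<forall>x x' y y' z z'. (x', y, z) \<in> M \<longrightarrow> (x, y', z) \<in> M \<longrightarrow> (x, y, z') \<in> M \<longrightarrow> (x, y, z) \<in> M)"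

definition shadow :: "('a \<times> 'a \<times> 'a) set \<Rightarrow> 'a \<times> 'a \<Rightarrow> real" where
  "shadow M = (\<lambda>(x, y). of_bool (\<exists>z. (x, y, z) \<in> M))"

text \<open>From \<open>10 * \<delta> * n\<^sup>2\<close> triples, five atypical kinds of at most
  \<open>\<delta> * n\<^sup>2\<close> each are discarded. In every pair of cells still met by a
  triple, the link of one chosen \<open>z\<close> spans a rectangle of relative size at least
  \<open>\<delta>\<^sup>2\<close> on which the shadow is a matching. The pair itself has density at
  least \<delta>, so cutting the cells along these rectangles gains energy.\<close>

lemma ruzsa_szemeredi_energy_step:
  fixes \<delta> :: real and V :: "'a set" and c :: "'a \<Rightarrow> nat"
  assumes V: "finite V" and M: "M \<subseteq> V \<times> V \<times> V" and rs: "ruzsa_szemeredi M"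
    and \<delta>: "0 < \<delta>" and c: "c ` V \<subseteq> {..<K}" and ne: "V \<noteq> {}"
    and large: "2 * real K / \<delta> ^ 3 \<le> card V"
    and dense: "10 * \<delta> * (card V)\<^sup>2 \<le> card M"
  shows "\<exists>c'. c' ` V \<subseteq> {..<K * 4 ^ K} \<and>
    energy (V \<times> V) (map_prod c c) (shadow M) + 5 * \<delta> ^ 5 / 4 * (card V)\<^sup>2
      \<le> energy (V \<times> V) (map_prod c' c') (shadow M)"
proof -
  define n where "n = card V"
  define A where "A z = {x. \<exists>y. (x, y, z) \<in> M}" for z
  define B where "B z = {y. \<exists>x. (x, y, z) \<in> M}" for z
  define P where "P x = {x' \<in> V. c x' = c x}" for x
  have finP: "finite (P x)" for x using V by (simp add: P_def)
  define f where "f = shadow M"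
  define C where "C = map_prod c c"
  have inj1: "x = x'" if "(x, y, z) \<in> M" "(x', y, z) \<in> M" for x x' y z
    using rs that unfolding ruzsa_szemeredi_def by blast
  have inj2: "y = y'" if "(x, y, z) \<in> M" "(x, y', z) \<in> M" for x y y' z
    using rs that unfolding ruzsa_szemeredi_def by blast
  have inj3: "z = z'" if "(x, y, z) \<in> M" "(x, y, z') \<in> M" for x y z z'
    using rs that unfolding ruzsa_szemeredi_def by blast
  have closed: "(x, y, z) \<in> M" if "(x', y, z) \<in> M" "(x, y', z) \<in> M" "(x, y, z') \<in> M"
    for x x' y y' z z'
    using rs that unfolding ruzsa_szemeredi_def by blast
  have n0: "n > 0" using V ne by (simp add: n_def card_gt_0_iff)
  have K0: "K > 0" using c ne by auto
  have finM: "finite M" using M V by (meson finite_SigmaI finite_subset)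
  \<comment> \<open>Any two coordinates determine the third, so a set of triples can be counted
    through whichever projection suits.\<close>
  have inj12: "inj_on (\<lambda>(x, y, z). (x, y)) M'" if "M' \<subseteq> M" for M'
    using that by (auto simp: inj_on_def dest: inj3)
  have inj13: "inj_on (\<lambda>(x, y, z). (z, x)) M'" if "M' \<subseteq> M" for M'
    using that by (auto simp: inj_on_def dest: inj2)
  have inj23: "inj_on (\<lambda>(x, y, z). (z, y)) M'" if "M' \<subseteq> M" for M'
    using that by (auto simp: inj_on_def dest: inj1)

  define avgA where "avgA z = cond_avg V c (\<lambda>x. of_bool (x \<in> A z))" for z
  define avgB where "avgB z = cond_avg V c (\<lambda>x. of_bool (x \<in> B z))" for z
  define avgE where "avgE = cond_avg (V \<times> V) C f"
  \<comment> \<open>The atypical triples: \<open>M1\<close> and \<open>M2\<close> use a small cell,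
    \<open>M3\<close> a sparse pair of cells, \<open>M4\<close> and \<open>M5\<close> a cell in
    which the link of \<open>z\<close> is sparse.\<close>
  define M1 where "M1 = {(x, y, z) \<in> M. card (P x) < \<delta> * n / K}"
  define M2 where "M2 = {(x, y, z) \<in> M. card (P y) < \<delta> * n / K}"
  define M3 where "M3 = {(x, y, z) \<in> M. avgE (x, y) < \<delta>}"
  define M4 where "M4 = {(x, y, z) \<in> M. avgA z x < \<delta>}"
  define M5 where "M5 = {(x, y, z) \<in> M. avgB z y < \<delta>}"
  define M0 where "M0 = M - (M1 \<union> M2 \<union> M3 \<union> M4 \<union> M5)"
  have sub: "M0 \<subseteq> M" "M1 \<subseteq> M" "M2 \<subseteq> M" "M3 \<subseteq> M" "M4 \<subseteq> M" "M5 \<subseteq> M"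
    by (auto simp: M0_def M1_def M2_def M3_def M4_def M5_def)

  \<comment> \<open>At most \<open>K\<close> cells are small, each with fewer than
    \<open>\<delta> * n / K\<close> vertices; this explains the threshold.\<close>
  define X where "X = {x \<in> V. card (P x) < \<delta> * n / K}"
  have "card X \<le> \<delta> * n"
  proof -
    have "real (card X) = (\<Sum>k\<in>c ` X. real (card {x \<in> X. c x = k}))"
      using sum.image_gen[of X "\<lambda>_. 1::nat" c] V by (simp add: X_def flip: of_nat_sum)
    also have "\<dots> \<le> (\<Sum>k\<in>c ` X. \<delta> * n / K)"
    proof (rule sum_mono)
      fix k assume "k \<in> c ` X"
      then obtain x where x: "x \<in> X" "k = c x" by auto
      have "card {x \<in> X. c x = k} \<le> card (P x)"
        by (rule card_mono) (use V x in \<open>auto simp: P_def X_def\<close>)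
      also have "\<dots> \<le> \<delta> * n / K" using x by (simp add: X_def)
      finally show "card {x \<in> X. c x = k} \<le> \<delta> * n / K" by simp
    qed
    also have "\<dots> \<le> (\<Sum>k<K. \<delta> * n / K)"
      by (rule sum_mono2) (use c \<delta> in \<open>auto simp: X_def\<close>)
    also have "\<dots> = \<delta> * n" using K0 by simp
    finally show ?thesis .
  qed
  then have XV: "real (card X) * n \<le> \<delta> * n\<^sup>2"
    by (simp add: power2_eq_square mult_right_mono flip: mult.assoc)
  have "card M1 \<le> card (X \<times> V)"
    by (rule card_inj_on_le[OF inj12[OF sub(2)]]) (use V M in \<open>auto simp: M1_def X_def\<close>)
  then have b1: "card M1 \<le> \<delta> * n\<^sup>2"
    using XV by (simp add: card_cartesian_product n_def flip: of_nat_mult)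
  have "card M2 \<le> card (V \<times> X)"
    by (rule card_inj_on_le[OF inj12[OF sub(3)]]) (use V M in \<open>auto simp: M2_def X_def\<close>)
  then have b2: "card M2 \<le> \<delta> * n\<^sup>2"
    using XV by (simp add: card_cartesian_product n_def mult.commute flip: of_nat_mult)
  have b3: "card M3 \<le> \<delta> * n\<^sup>2"
  proof -
    let ?T = "{p. p \<in> V \<times> V \<and> avgE p < \<delta>}"
    have fin: "finite ?T" using V by simp
    have "card M3 \<le> card (?T \<inter> {p. \<exists>z. (fst p, snd p, z) \<in> M})"
      by (rule card_inj_on_le[OF inj12[OF sub(4)]]) (use V M in \<open>auto simp: M3_def\<close>)
    also have "\<dots> = sum f ?T"
      using fin by (simp add: f_def shadow_def case_prod_beta' sum_of_bool_eq)
    also have "\<dots> \<le> \<delta> * card (V \<times> V)"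
      unfolding avgE_def by (rule sum_low_density_le) (use V \<delta> in auto)
    finally show ?thesis by (simp add: card_cartesian_product n_def power2_eq_square)
  qed
  \<comment> \<open>For each \<open>z\<close>, one side of its link has few elements in cells where
    it is sparse. The bound variable \<open>A\<close> shadows the fixed one, so that the fact serves
    both \<open>A\<close> and \<open>B\<close>.\<close>
  have low: "(\<Sum>z\<in>V. real (card {x \<in> V. cond_avg V c (\<lambda>x. of_bool (x \<in> A z)) x < \<delta> \<and> x \<in> A z})) \<le> \<delta> * n\<^sup>2"
    for A :: "'a \<Rightarrow> 'a set"
  proof -
    have "(\<Sum>z\<in>V. real (card {x \<in> V. cond_avg V c (\<lambda>x. of_bool (x \<in> A z)) x < \<delta> \<and> x \<in> A z}))
      \<le> (\<Sum>z\<in>V. \<delta> * n)"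
    proof (rule sum_mono)
      fix z
      let ?T = "{x. x \<in> V \<and> cond_avg V c (\<lambda>x. of_bool (x \<in> A z)) x < \<delta>}"
      have "real (card {x \<in> V. cond_avg V c (\<lambda>x. of_bool (x \<in> A z)) x < \<delta> \<and> x \<in> A z})
        = (\<Sum>x\<in>?T. of_bool (x \<in> A z))"
        using V by (simp add: Int_def conj_assoc)
      also have "\<dots> \<le> \<delta> * n"
        unfolding n_def by (rule sum_low_density_le) (use V \<delta> in auto)
      finally show "real (card {x \<in> V. cond_avg V c (\<lambda>x. of_bool (x \<in> A z)) x < \<delta> \<and> x \<in> A z}) \<le> \<delta> * n" .
    qed
    then show ?thesis by (simp add: n_def power2_eq_square mult_ac)
  qed
  have "card M4 \<le> card (SIGMA z:V. {x \<in> V. avgA z x < \<delta> \<and> x \<in> A z})"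
    by (rule card_inj_on_le[OF inj13[OF sub(5)]]) (use V M in \<open>auto simp: M4_def A_def\<close>)
  then have b4: "card M4 \<le> \<delta> * n\<^sup>2"
    using low[of A] V by (simp add: avgA_def flip: of_nat_sum)
  have "card M5 \<le> card (SIGMA z:V. {x \<in> V. avgB z x < \<delta> \<and> x \<in> B z})"
    by (rule card_inj_on_le[OF inj23[OF sub(6)]]) (use V M in \<open>auto simp: M5_def B_def\<close>)
  then have b5: "card M5 \<le> \<delta> * n\<^sup>2"
    using low[of B] V by (simp add: avgB_def flip: of_nat_sum)
  have M0: "5 * \<delta> * n\<^sup>2 \<le> card M0"
  proof -
    have "card M \<le> card (M0 \<union> M1 \<union> M2 \<union> M3 \<union> M4 \<union> M5)"
      by (rule card_mono) (use finM sub in \<open>auto simp: M0_def intro: finite_subset\<close>)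
    also have "\<dots> \<le> card M0 + card M1 + card M2 + card M3 + card M4 + card M5"
      by (meson card_Un_le add_le_mono1 le_trans)
    finally have "real (card M) \<le> card M0 + card M1 + card M2 + card M3 + card M4 + card M5"
      by linarith
    then show ?thesis using b1 b2 b3 b4 b5 dense by (simp add: n_def)
  qed

  \<comment> \<open>The union of the full pairs of cells that contain a surviving
    \<open>(x, y)\<close>.\<close>
  define G where "G = {p \<in> V \<times> V. \<exists>x y z. (x, y, z) \<in> M0 \<and> C (x, y) = C p}"
  have finG: "finite G" using V by (simp add: G_def)
  have "card M0 \<le> card G"
    by (rule card_inj_on_le[OF inj12[OF sub(1)] _ finG])
      (use M sub(1) in \<open>auto simp: G_def\<close>)
  then have G: "5 * \<delta> * n\<^sup>2 \<le> card G" using M0 by linarith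
  \<comment> \<open>One \<open>z\<close> per pair of colours, not per pair of vertices, so only
    boundedly many links enter the new colouring. Where no triple survives the value is arbitrary,
    but such pairs lie outside \<open>G\<close> and hence outside \<open>S\<close>.\<close>
  define \<zeta> where "\<zeta> k l = (SOME z. \<exists>x y. (x, y, z) \<in> M0 \<and> c x = k \<and> c y = l)" for k l
  define S where "S = {p \<in> G. fst p \<in> A (\<zeta> (c (fst p)) (c (snd p))) \<and> snd p \<in> B (\<zeta> (c (fst p)) (c (snd p)))}"
  have finS: "finite S" using finG by (simp add: S_def)
  \<comment> \<open>All of this depends only on the colours of \<open>x\<close> and
    \<open>y\<close>, so it is read off a surviving triple \<open>(x', y', z)\<close> in the same
    cells.\<close>
  have key: "\<delta> \<le> avgE (x, y)" "{q \<in> G. C q = C (x, y)} = P x \<times> P y"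
    "{q \<in> S. C q = C (x, y)} = (A (\<zeta> (c x) (c y)) \<inter> P x) \<times> (B (\<zeta> (c x) (c y)) \<inter> P y)"
    "\<delta> * card (P x) \<le> card (A (\<zeta> (c x) (c y)) \<inter> P x)"
    "\<delta> * card (P y) \<le> card (B (\<zeta> (c x) (c y)) \<inter> P y)"
    "\<delta> * n / K \<le> card (P x)" "\<delta> * n / K \<le> card (P y)"
    if "(x, y) \<in> G" for x y
  proof -
    define z where "z = \<zeta> (c x) (c y)"
    have "\<exists>z x' y'. (x', y', z) \<in> M0 \<and> c x' = c x \<and> c y' = c y"
      using that by (auto simp: G_def C_def)
    then have "\<exists>x' y'. (x', y', z) \<in> M0 \<and> c x' = c x \<and> c y' = c y"
      unfolding z_def \<zeta>_def by (rule someI_ex)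
    then obtain x' y' where *: "(x', y', z) \<in> M0" "c x' = c x" "c y' = c y" by auto
    have V2: "x \<in> V" "y \<in> V" using that by (auto simp: G_def)
    have cE: "avgE (x', y') = avgE (x, y)" and cA: "avgA z x' = avgA z x" and cB: "avgB z y' = avgB z y"
      and cP: "P x' = P x" "P y' = P y"
      using * by (auto simp: avgE_def avgA_def avgB_def P_def C_def cond_avg_def)
    have **: "(x', y', z) \<in> M" "(x', y', z) \<notin> M1" "(x', y', z) \<notin> M2" "(x', y', z) \<notin> M3"
       "(x', y', z) \<notin> M4" "(x', y', z) \<notin> M5"
      using *(1) by (auto simp: M0_def)
    show "\<delta> \<le> avgE (x, y)" using **(1,4) cE by (simp add: M3_def)
    show "\<delta> * n / K \<le> card (P x)" using **(1,2) cP by (simp add: M1_def)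
    show "\<delta> * n / K \<le> card (P y)" using **(1,3) cP by (simp add: M2_def)
    have pos: "card (P x) > 0" "card (P y) > 0" using V V2 by (auto simp: P_def card_gt_0_iff)
    have dens: "cond_avg V c (\<lambda>x. of_bool (x \<in> A)) u = card (A \<inter> P u) / card (P u)" for A u
      using V by (simp add: cond_avg_def P_def Int_commute)
    have "\<delta> \<le> avgA z x" "\<delta> \<le> avgB z y"
      using **(1,5,6) cA cB by (simp_all add: M4_def M5_def)
    show "\<delta> * card (P x) \<le> card (A (\<zeta> (c x) (c y)) \<inter> P x)"
      using \<open>\<delta> \<le> avgA z x\<close> pos by (simp add: avgA_def dens pos_le_divide_eq flip: z_def)
    show "\<delta> * card (P y) \<le> card (B (\<zeta> (c x) (c y)) \<inter> P y)"
      using \<open>\<delta> \<le> avgB z y\<close> pos by (simp add: avgB_def dens pos_le_divide_eq flip: z_def)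
    show G': "{q \<in> G. C q = C (x, y)} = P x \<times> P y"
      using * by (auto simp: G_def P_def C_def) blast+
    have "{q \<in> S. C q = C (x, y)} = {q \<in> {q \<in> G. C q = C (x, y)}. fst q \<in> A z \<and> snd q \<in> B z}"
      by (auto simp: S_def C_def z_def)
    also have "\<dots> = (A z \<inter> P x) \<times> (B z \<inter> P y)"
      unfolding G' by auto
    finally show "{q \<in> S. C q = C (x, y)} = (A (\<zeta> (c x) (c y)) \<inter> P x) \<times> (B (\<zeta> (c x) (c y)) \<inter> P y)"
      by (simp add: z_def)
  qed
  have "S \<subseteq> G" by (auto simp: S_def)
  have "\<delta>\<^sup>2 * card G \<le> card S"
  proof -
    have "(\<Sum>p\<in>G. \<delta>\<^sup>2) \<le> (\<Sum>p\<in>G. of_bool (p \<in> S))"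
    proof (rule sum_le_sum_if_fiberwise[OF finG, where C=C])
      fix p assume "p \<in> G"
      moreover obtain x y where p: "p = (x, y)" by force
      ultimately have xy: "(x, y) \<in> G" by simp
      have "{q \<in> G. C q = C p} \<inter> {q. q \<in> S} = {q \<in> S. C q = C p}"
        using \<open>S \<subseteq> G\<close> by auto
      moreover have "(\<delta> * card (P x)) * (\<delta> * card (P y))
        \<le> real (card (A (\<zeta> (c x) (c y)) \<inter> P x)) * card (B (\<zeta> (c x) (c y)) \<inter> P y)"
        by (rule mult_mono) (use key[OF xy] \<delta> in auto)
      ultimately show "(\<Sum>q | q \<in> G \<and> C q = C p. \<delta>\<^sup>2) \<le> (\<Sum>q | q \<in> G \<and> C q = C p. of_bool (q \<in> S))"
        using finP by (simp add: p key[OF xy] card_cartesian_product power2_eq_square mult_ac)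
    qed
    then show ?thesis using finG \<open>S \<subseteq> G\<close> by (simp add: Int_absorb1 mult.commute)
  qed
  then have cardS: "5 * \<delta> ^ 3 * n\<^sup>2 \<le> card S"
    using mult_left_mono[OF G, of "\<delta>\<^sup>2"] by (simp add: power2_eq_square power3_eq_cube mult_ac)
  have "sum f S \<le> (\<Sum>p\<in>S. \<delta> / 2)"
  proof (rule sum_le_sum_if_fiberwise[OF finS, where C=C])
    fix p assume "p \<in> S"
    moreover obtain x y where p: "p = (x, y)" by force
    ultimately have xy: "(x, y) \<in> G" using \<open>S \<subseteq> G\<close> by auto
    define z where "z = \<zeta> (c x) (c y)"
    let ?A = "A z \<inter> P x" and ?B = "B z \<inter> P y"
    have "(\<Sum>q | q \<in> S \<and> C q = C p. f q) = real (card ((?A \<times> ?B) \<inter> {p. \<exists>w. (fst p, snd p, w) \<in> M}))"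
      unfolding p key(3)[OF xy] using finP
      by (simp add: f_def shadow_def case_prod_beta' z_def)
    also have "\<dots> \<le> card ?A"
    proof -
      \<comment> \<open>Both \<open>u\<close> and \<open>v\<close> are joined to \<open>z\<close>,
        so a shadow edge between them completes a triangle, which must be a triple of
        \<open>M\<close>. Hence each \<open>u\<close> has at most one partner
        \<open>v\<close>.\<close>
      have *: "(u, v, z) \<in> M" if "u \<in> ?A" "v \<in> ?B" "(u, v, w) \<in> M" for u v w
      proof -
        have "\<exists>y'. (u, y', z) \<in> M" "\<exists>x'. (x', v, z) \<in> M" using that by (auto simp: A_def B_def)
        then show ?thesis using that(3) closed by blast
      qed
      have "inj_on fst ((?A \<times> ?B) \<inter> {p. \<exists>w. (fst p, snd p, w) \<in> M})"
      proof (rule inj_onI)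
        fix p q assume "p \<in> (?A \<times> ?B) \<inter> {p. \<exists>w. (fst p, snd p, w) \<in> M}"
          "q \<in> (?A \<times> ?B) \<inter> {p. \<exists>w. (fst p, snd p, w) \<in> M}" "fst p = fst q"
        then have "(fst p, snd p, z) \<in> M" "(fst p, snd q, z) \<in> M"
          using *[of "fst p" "snd p"] *[of "fst q" "snd q"] by auto
        then show "p = q" using inj2 \<open>fst p = fst q\<close> by (auto intro: prod_eqI)
      qed
      then show ?thesis
        using finP by (auto intro!: card_inj_on_le)
    qed
    also have "\<dots> \<le> \<delta> / 2 * card ?B * card ?A"
    proof -
      \<comment> \<open>The lower bound on \<open>card V\<close> gives \<open>?B\<close> at least
        \<open>2 / \<delta>\<close> vertices, so a matching has density at most
        \<open>\<delta> / 2\<close> in the rectangle.\<close>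
      have "2 / \<delta> = \<delta> * (\<delta> * (2 * K / \<delta> ^ 3) / K)"
        using K0 \<delta> by (simp add: field_simps power3_eq_cube)
      also have "\<dots> \<le> \<delta> * (\<delta> * n / K)"
        using large \<delta> by (intro mult_left_mono divide_right_mono) (auto simp: n_def)
      also have "\<dots> \<le> \<delta> * card (P y)"
        using key(7)[OF xy] \<delta> by (intro mult_left_mono) auto
      also have "\<dots> \<le> card ?B"
        using key(5)[OF xy] by (simp add: z_def)
      finally have "1 \<le> \<delta> / 2 * card ?B"
        using \<delta> by (simp add: field_simps)
      then show ?thesis
        using mult_right_mono[of 1 "\<delta> / 2 * card ?B" "card ?A"] by simp
    qed
    also have "\<dots> = (\<Sum>q | q \<in> S \<and> C q = C p. \<delta> / 2)"
      by (simp add: p key(3)[OF xy] card_cartesian_product z_def)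
    finally show "(\<Sum>q | q \<in> S \<and> C q = C p. f q) \<le> (\<Sum>q | q \<in> S \<and> C q = C p. \<delta> / 2)" .
  qed
  then have sparse: "sum f S \<le> \<delta> / 2 * card S" by (simp add: mult.commute)

  \<comment> \<open>The new colour keeps the old one and records the chosen links containing
    \<open>x\<close>, as first coordinate against each \<open>l\<close> and as second against each
    \<open>k\<close>. The \<open>K * 2 ^ K * 2 ^ K\<close> values are renumbered by
    \<open>h\<close>, so that the step can be iterated.\<close>
  define c0 where "c0 x = (c x, {l \<in> {..<K}. x \<in> A (\<zeta> (c x) l)}, {k \<in> {..<K}. x \<in> B (\<zeta> k (c x))})" for x
  let ?T = "{..<K} \<times> Pow {..<K} \<times> Pow {..<K}"
  have "(4 :: nat) ^ K = 2 ^ K * 2 ^ K" by (simp flip: power_mult_distrib)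
  then have "card ?T = K * 4 ^ K"
    by (simp add: card_cartesian_product card_Pow)
  then obtain h where h: "bij_betw h ?T {0..<K * 4 ^ K}"
    using ex_bij_betw_finite_nat[of ?T] by auto
  define c' where "c' = h \<circ> c0"
  have c0: "c0 x \<in> ?T" if "x \<in> V" for x
    using that c by (auto simp: c0_def)
  have c'eq: "c0 x = c0 y" if "x \<in> V" "y \<in> V" "c' x = c' y" for x y
    using that by (intro inj_onD[OF bij_betw_imp_inj_on[OF h] _ c0 c0]) (simp_all add: c'_def)
  have "c' ` V \<subseteq> {..<K * 4 ^ K}"
    using bij_betw_apply[OF h c0] by (simp add: c'_def image_subset_iff)
  moreover have "energy (V \<times> V) C f + \<delta>\<^sup>2 / 4 * card S \<le> energy (V \<times> V) (map_prod c' c') f"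
  proof (rule energy_increment)
    show "C p = C q" if "p \<in> V \<times> V" "q \<in> V \<times> V" "map_prod c' c' p = map_prod c' c' q" for p q
    proof -
      have "c0 (fst p) = c0 (fst q)" "c0 (snd p) = c0 (snd q)"
        using that by (auto intro!: c'eq)
      then show ?thesis by (cases p, cases q) (simp add: C_def c0_def)
    qed
    show "S \<subseteq> V \<times> V" by (auto simp: S_def G_def)
    show "\<delta> \<le> cond_avg (V \<times> V) C f p" if "p \<in> S" for p
      using key(1)[of "fst p" "snd p"] that \<open>S \<subseteq> G\<close> by (auto simp: avgE_def)
    show "q \<in> S" if "p \<in> S" "q \<in> V \<times> V" "map_prod c' c' p = map_prod c' c' q" for p q
    proof -
      obtain x y where p: "p = (x, y)" by force
      obtain x' y' where q: "q = (x', y')" by force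
      have pG: "(x, y) \<in> G" using that p \<open>S \<subseteq> G\<close> by auto
      have xy: "x \<in> V" "y \<in> V" "x' \<in> V" "y' \<in> V" using pG that q by (auto simp: G_def)
      have c'xy: "c' x = c' x'" "c' y = c' y'" using that(3) by (simp_all add: p q)
      have eq: "c0 x = c0 x'" "c0 y = c0 y'" using xy c'xy by (auto intro: c'eq)
      then have ceq: "c x' = c x" "c y' = c y" by (auto simp: c0_def)
      have lt: "c x < K" "c y < K" using c xy by auto
      \<comment> \<open>\<open>c0\<close> decides this membership by its entry at
        \<open>l = c y\<close>, which is below \<open>K\<close>.\<close>
      have "x' \<in> A (\<zeta> (c x) (c y)) \<longleftrightarrow> x \<in> A (\<zeta> (c x) (c y))"
        using eq(1) lt(2) ceq(1) by (auto simp: c0_def set_eq_iff)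
      moreover have "y' \<in> B (\<zeta> (c x) (c y)) \<longleftrightarrow> y \<in> B (\<zeta> (c x) (c y))"
        using eq(2) lt(1) ceq(2) by (auto simp: c0_def set_eq_iff)
      moreover have "q \<in> G"
        using pG xy ceq by (simp add: G_def q C_def)
      ultimately show ?thesis
        using that(1) ceq by (simp add: S_def p q)
    qed
  qed (use V \<delta> sparse in auto)
  moreover have "5 * \<delta> ^ 5 / 4 * n\<^sup>2 \<le> \<delta>\<^sup>2 / 4 * card S"
    using mult_left_mono[OF cardS, of "\<delta>\<^sup>2 / 4"] power_add[of \<delta> 2 3] by simp
  ultimately show ?thesis
    unfolding f_def C_def n_def by (intro exI[of _ c'] conjI) (assumption, linarith)
qed

text \<open>With too many triples the energy step could be repeated until the energy exceeds
  \<open>(card V)\<^sup>2\<close>, the bound for any 0/1-valued function on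
  \<open>V \<times> V\<close>.\<close>

theorem ruzsa_szemeredi_card_le:
  fixes \<epsilon> :: real
  assumes "0 < \<epsilon>"
  shows "\<exists>N. \<forall>(V :: 'a set) M. finite V \<longrightarrow> N \<le> card V \<longrightarrow> M \<subseteq> V \<times> V \<times> V \<longrightarrow>
    ruzsa_szemeredi M \<longrightarrow> card M \<le> \<epsilon> * (card V)\<^sup>2"
proof -
  \<comment> \<open>The \<open>10\<close> matches the density hypothesis of the energy step, and
    \<gamma> is the gain of one round relative to \<open>(card V)\<^sup>2\<close>.\<close>
  define \<delta> where "\<delta> = \<epsilon> / 10"
  define \<gamma> where "\<gamma> = 5 * \<delta> ^ 5 / 4"
  have \<delta>: "0 < \<delta>" and \<gamma>: "0 < \<gamma>" using assms by (auto simp: \<delta>_def \<gamma>_def)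
  \<comment> \<open>\<open>K\<close> and \<open>N\<close> are chosen before \<open>V\<close> and
    \<open>M\<close>, which makes the final threshold uniform.\<close>
  have iter: "\<exists>(K::nat) N. \<forall>(V :: 'a set) M. finite V \<longrightarrow> N \<le> card V \<longrightarrow> M \<subseteq> V \<times> V \<times> V \<longrightarrow>
    ruzsa_szemeredi M \<longrightarrow> \<epsilon> * (card V)\<^sup>2 < card M \<longrightarrow>
    (\<exists>c. c ` V \<subseteq> {..<K} \<and> real j * \<gamma> * (card V)\<^sup>2 \<le> energy (V \<times> V) (map_prod c c) (shadow M))" for j
  proof (induction j)
    case 0
    have "\<exists>c. c ` V \<subseteq> {..<1::nat} \<and> real 0 * \<gamma> * (card V)\<^sup>2 \<le> energy (V \<times> V) (map_prod c c) (shadow M)"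
      for V :: "'a set" and M
      by (rule exI[of _ "\<lambda>_. 0 :: nat"]) (auto simp: energy_nonneg)
    then show ?case by blast
  next
    case (Suc j)
    then obtain K :: nat and N where KN: "\<exists>c. c ` V \<subseteq> {..<K} \<and>
        real j * \<gamma> * (card V)\<^sup>2 \<le> energy (V \<times> V) (map_prod c c) (shadow M)"
      if "finite V" "N \<le> card V" "M \<subseteq> V \<times> V \<times> V" "ruzsa_szemeredi M" "\<epsilon> * (card V)\<^sup>2 < card M"
      for V :: "'a set" and M
      by blast
    \<comment> \<open>The \<open>1\<close> makes \<open>V\<close> nonempty; the rounded term is the
      size that the energy step requires for \<open>K\<close> classes.\<close>
    let ?N = "max (max 1 N) (nat \<lceil>2 * real K / \<delta> ^ 3\<rceil>)"
    have "\<exists>c. c ` V \<subseteq> {..<K * 4 ^ K} \<and>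
        real (Suc j) * \<gamma> * (card V)\<^sup>2 \<le> energy (V \<times> V) (map_prod c c) (shadow M)"
      if *: "finite V" "?N \<le> card V" "M \<subseteq> V \<times> V \<times> V" "ruzsa_szemeredi M" "\<epsilon> * (card V)\<^sup>2 < card M"
      for V :: "'a set" and M
    proof -
      obtain c where c: "c ` V \<subseteq> {..<K}"
        "real j * \<gamma> * (card V)\<^sup>2 \<le> energy (V \<times> V) (map_prod c c) (shadow M)"
        using KN[of V M] * by auto
      have "V \<noteq> {}" using *(2) by auto
      moreover have "2 * real K / \<delta> ^ 3 \<le> card V" using *(2) by linarith
      ultimately obtain c' where c': "c' ` V \<subseteq> {..<K * 4 ^ K}"
        "energy (V \<times> V) (map_prod c c) (shadow M) + 5 * \<delta> ^ 5 / 4 * (card V)\<^sup>2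
          \<le> energy (V \<times> V) (map_prod c' c') (shadow M)"
        using ruzsa_szemeredi_energy_step[of V M \<delta> c K] * c \<delta> by (auto simp: \<delta>_def)
      then show ?thesis
        using c(2) by (intro exI[of _ c']) (auto simp: algebra_simps \<gamma>_def)
    qed
    then show ?case by blast
  qed
  \<comment> \<open>After this many rounds the energy would exceed its upper bound.\<close>
  obtain j :: nat where j: "1 < real j * \<gamma>"
    using \<gamma> reals_Archimedean3 by blast
  obtain K :: nat and N where KN: "\<exists>c. c ` V \<subseteq> {..<K} \<and>
      real j * \<gamma> * (card V)\<^sup>2 \<le> energy (V \<times> V) (map_prod c c) (shadow M)"
    if "finite V" "N \<le> card V" "M \<subseteq> V \<times> V \<times> V" "ruzsa_szemeredi M" "\<epsilon> * (card V)\<^sup>2 < card M"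
    for V :: "'a set" and M
    using iter[of j] by blast
  have "card M \<le> \<epsilon> * (card V)\<^sup>2"
    if *: "finite V" "max 1 N \<le> card V" "M \<subseteq> V \<times> V \<times> V" "ruzsa_szemeredi M" for V :: "'a set" and M
  proof (rule ccontr)
    assume "\<not> ?thesis"
    then obtain c :: "'a \<Rightarrow> nat" where c: "real j * \<gamma> * (card V)\<^sup>2 \<le> energy (V \<times> V) (map_prod c c) (shadow M)"
      using KN[of V M] * by auto
    also have "\<dots> \<le> (\<Sum>p\<in>V \<times> V. (shadow M p)\<^sup>2)"
      by (rule energy_le) (use * in simp)
    also have "\<dots> \<le> (\<Sum>p\<in>V \<times> V. 1)"
      by (rule sum_mono) (auto simp: shadow_def)
    also have "\<dots> = (real (card V))\<^sup>2"
      by (simp add: card_cartesian_product power2_eq_square)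
    finally show False using j *(2) by (auto simp: mult_le_cancel_right1)
  qed
  then show ?thesis by blast
qed

section \<open>Separated families of independent sets\<close>

text \<open>Sorting represents each three-element set by a single ordered triple, whose positions
  serve as the three parts of the tripartite graph.\<close>

definition link_triples :: "'a::linorder set set \<Rightarrow> 'a set \<Rightarrow> ('a \<times> 'a \<times> 'a) set" where
  "link_triples F S = {(x, y, z). x < y \<and> y < z \<and> {x, y, z} \<inter> S = {} \<and> {x, y, z} \<union> S \<in> F}"

text \<open>Distance at least 3 in the configuration graph, spelled out as being neither adjacent
  nor joined through a common neighbour \<open>W\<close>.\<close>

definition separated :: "nat \<Rightarrow> 'a pair_pre_digraph \<Rightarrow> 'a set set \<Rightarrow> bool" where
  "separated k G F \<longleftrightarrow> (\<forall>I\<in>F. \<forall>J\<in>F. I \<noteq> J \<longrightarrow> card (I \<inter> J) \<noteq> k - 1 \<and>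
     (\<forall>W. independent_set G W \<longrightarrow> card W = k \<longrightarrow> card (I \<inter> W) = k - 1 \<longrightarrow> card (W \<inter> J) \<noteq> k - 1))"

lemma separatedD:
  assumes "separated k G F" "I \<in> F" "J \<in> F" "I \<noteq> J"
  shows "card (I \<inter> J) \<noteq> k - 1"
    and "independent_set G W \<Longrightarrow> card W = k \<Longrightarrow> card (I \<inter> W) = k - 1 \<Longrightarrow> card (W \<inter> J) \<noteq> k - 1"
  using assms unfolding separated_def by blast+

text \<open>Independence is a condition on pairs; the case \<open>u = v\<close> covers membership in
  \<open>pverts G\<close>.\<close>

lemma independent_setI:
  assumes "\<And>u v. u \<in> W \<Longrightarrow> v \<in> W \<Longrightarrow> \<exists>I. independent_set G I \<and> {u, v} \<subseteq> I"
  shows "independent_set G W"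
proof -
  have "u \<in> pverts G \<and> (u, v) \<notin> parcs G" if "u \<in> W" "v \<in> W" for u v
    using assms[OF that] by (auto simp: independent_set_def)
  then show ?thesis by (auto simp: independent_set_def)
qed

text \<open>Distinct members of \<open>F\<close> sharing \<open>S\<close> and two further vertices
  would be adjacent, which gives the uniqueness clauses. In the closure clause, a foreign triangle
  \<open>xyz\<close> would make \<open>{x, y, z} \<union> S\<close> a common neighbour of two
  members.\<close>

lemma ruzsa_szemeredi_link_triples:
  fixes F :: "'a::linorder set set"
  assumes sep: "separated k G F" and ind: "\<And>I. I \<in> F \<Longrightarrow> independent_set G I"
    and S: "finite S" "card S + 3 = k"
  shows "ruzsa_szemeredi (link_triples F S)"
proof -
  have swap: "card (({a, b, c} \<union> S) \<inter> ({a, b, d} \<union> S)) = k - 1"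
    if "a \<noteq> b" "c \<noteq> d" "c \<noteq> a" "c \<noteq> b" "d \<noteq> a" "d \<noteq> b" "{a, b, c, d} \<inter> S = {}" for a b c d
  proof -
    have "({a, b, c} \<union> S) \<inter> ({a, b, d} \<union> S) = {a, b} \<union> S"
      using that by auto
    moreover have "card ({a, b} \<union> S) = k - 1"
      using that S by (simp add: card_insert_if)
    ultimately show ?thesis by simp
  qed
  have uniq: "c = d" if "{a, b, c} \<union> S \<in> F" "{a, b, d} \<union> S \<in> F" "a \<noteq> b" "c \<noteq> a" "c \<noteq> b" "d \<noteq> a" "d \<noteq> b"
    "{a, b, c, d} \<inter> S = {}" for a b c d
  proof (rule ccontr)
    assume "c \<noteq> d"
    then have "{a, b, c} \<union> S \<noteq> {a, b, d} \<union> S" using that by auto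
    then have "card (({a, b, c} \<union> S) \<inter> ({a, b, d} \<union> S)) \<noteq> k - 1"
      using separatedD(1)[OF sep that(1,2)] by simp
    then show False
      using swap[of a b c d] that \<open>c \<noteq> d\<close> by simp
  qed
  show ?thesis
    unfolding ruzsa_szemeredi_def
  proof (intro conjI allI impI)
    fix x x' y z assume "(x, y, z) \<in> link_triples F S" "(x', y, z) \<in> link_triples F S"
    then show "x = x'"
      by (intro uniq[of y z]) (auto simp: link_triples_def insert_commute)
  next
    fix x y y' z assume "(x, y, z) \<in> link_triples F S" "(x, y', z) \<in> link_triples F S"
    then show "y = y'"
      by (intro uniq[of x z]) (auto simp: link_triples_def insert_commute)
  next
    fix x y z z' assume "(x, y, z) \<in> link_triples F S" "(x, y, z') \<in> link_triples F S"
    then show "z = z'"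
      by (intro uniq[of x y]) (auto simp: link_triples_def insert_commute)
  next
    fix x x' y y' z z'
    assume C: "(x', y, z) \<in> link_triples F S" and B: "(x, y', z) \<in> link_triples F S"
      and A: "(x, y, z') \<in> link_triples F S"
    have lt: "x < y" "y < z" and disj: "{x, y, z, x', y', z'} \<inter> S = {}"
      and FA: "{x, y, z'} \<union> S \<in> F" and FB: "{x, z, y'} \<union> S \<in> F" and FC: "{y, z, x'} \<union> S \<in> F"
      and ne: "y < z'" "x < y'" "y' < z"
      using A B C by (auto simp: link_triples_def insert_commute)
    have dist: "x \<noteq> y" "x \<noteq> z" "y \<noteq> z" "x \<noteq> z'" "y \<noteq> z'" "x \<noteq> y'" "y' \<noteq> z"
      using lt ne by - order+
    let ?W = "{x, y, z} \<union> S"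
    \<comment> \<open>With this equality the third given triple is already the required one.\<close>
    have "z = z'"
    proof (rule ccontr)
      assume zz: "z \<noteq> z'"
      show False
      \<comment> \<open>If \<open>y = y'\<close>, two given members share \<open>x\<close> and
        \<open>y\<close>, against uniqueness. Otherwise \<open>?W\<close> arises from one member by
        exchanging \<open>z'\<close> for \<open>z\<close> and from another by exchanging
        \<open>y'\<close> for \<open>y\<close>.\<close>
      proof (cases "y = y'")
        case True
        then show ?thesis
          using uniq[of x y z z'] FA FB dist disj zz by (auto simp: insert_commute)
      next
        case False
        have "independent_set G ?W"
        proof (rule independent_setI)
          fix u v assume "u \<in> ?W" "v \<in> ?W"
          then have "{u, v} \<subseteq> {x, y, z'} \<union> S \<or> {u, v} \<subseteq> {x, z, y'} \<union> S \<or> {u, v} \<subseteq> {y, z, x'} \<union> S"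
            by auto
          then show "\<exists>I. independent_set G I \<and> {u, v} \<subseteq> I"
            using ind[OF FA] ind[OF FB] ind[OF FC] by blast
        qed
        moreover have "card ?W = k"
          using S dist disj by (simp add: card_insert_if)
        moreover have "card (({x, y, z'} \<union> S) \<inter> ?W) = k - 1"
          by (rule swap) (use dist disj zz in auto)
        moreover have "card (({x, z, y} \<union> S) \<inter> ({x, z, y'} \<union> S)) = k - 1"
          by (rule swap) (use dist disj False in auto)
        then have "card (?W \<inter> ({x, z, y'} \<union> S)) = k - 1"
          by (simp add: insert_commute)
        moreover have "{x, y, z'} \<union> S \<noteq> {x, z, y'} \<union> S"
          using dist disj zz by auto
        ultimately show ?thesis
          using separatedD(2)[OF sep FA FB] by blast
      qed
    qed
    then show "(x, y, z) \<in> link_triples F S" using A by simp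
  qed
qed

lemma card_3_sorted:
  fixes T :: "'a::linorder set"
  assumes "card T = 3"
  obtains x y z where "x < y" "y < z" "T = {x, y, z}"
proof -
  obtain a b c where T: "T = {a, b, c}" "a \<noteq> b" "b \<noteq> c" "a \<noteq> c"
    using assms by (auto simp: card_3_iff)
  then consider "a < b" "b < c" | "a < c" "c < b" | "b < a" "a < c" | "b < c" "c < a" | "c < a" "a < b"
    | "c < b" "b < a"
    by (metis linorder_neq_iff)
  then show ?thesis
    by cases (use T that in \<open>auto simp: insert_commute\<close>)
qed

text \<open>Each member splits, possibly in several ways, into a set \<open>S\<close> of size
  \<open>k - 3\<close> and a sorted triple. There are at most \<open>card V ^ (k - 3)\<close> sets
  \<open>S\<close>, and the Ruzsa-Szemeredi bound applies to each.\<close>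

lemma card_separated_le:
  fixes \<epsilon> :: real
  assumes k: "3 \<le> k" and "0 < \<epsilon>"
  shows "\<exists>N. \<forall>(V :: 'a::linorder set) G F. finite V \<longrightarrow> N \<le> card V \<longrightarrow> pverts G = V \<longrightarrow>
    F \<subseteq> {I. independent_set G I \<and> card I = k} \<longrightarrow> separated k G F \<longrightarrow> card F \<le> \<epsilon> * card V ^ (k - 1)"
proof -
  obtain N where N: "card M \<le> \<epsilon> * (card V)\<^sup>2"
    if "finite V" "N \<le> card V" "M \<subseteq> V \<times> V \<times> V" "ruzsa_szemeredi M" for V :: "'a set" and M
    using ruzsa_szemeredi_card_le[OF \<open>0 < \<epsilon>\<close>] by blast
  have "card F \<le> \<epsilon> * card V ^ (k - 1)"
    if V: "finite V" "N \<le> card V" "pverts G = V"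
      and F: "F \<subseteq> {I. independent_set G I \<and> card I = k}" and sep: "separated k G F"
    for V :: "'a set" and G F
  proof -
    let ?\<S> = "{S. S \<subseteq> V \<and> card S = k - 3}"
    have fin: "finite ?\<S>" using V by simp
    have FV: "I \<subseteq> V" if "I \<in> F" for I
      using that F V by (auto simp: independent_set_def)
    have sub: "link_triples F S \<subseteq> V \<times> V \<times> V" for S
      using FV by (fastforce simp: link_triples_def)
    have finM: "finite (link_triples F S)" for S
      using sub V by (meson finite_SigmaI finite_subset)
    have "F \<subseteq> (\<Union>S\<in>?\<S>. (\<lambda>(x, y, z). {x, y, z} \<union> S) ` link_triples F S)"
    proof
      fix I assume I: "I \<in> F"
      then have cI: "card I = k" "finite I" using F V(1) FV by (auto intro: finite_subset)
      then obtain S where S: "S \<subseteq> I" "card S = k - 3"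
        using obtain_subset_with_card_n[of "k - 3" I] by auto
      have "card (I - S) = 3"
        using S cI k by (simp add: card_Diff_subset finite_subset)
      then obtain x y z where xyz: "x < y" "y < z" "I - S = {x, y, z}"
        by (rule card_3_sorted)
      then have "{x, y, z} \<union> S = I" "{x, y, z} \<inter> S = {}" using S by blast+
      then have "(x, y, z) \<in> link_triples F S"
        using xyz I by (simp add: link_triples_def)
      then show "I \<in> (\<Union>S\<in>?\<S>. (\<lambda>(x, y, z). {x, y, z} \<union> S) ` link_triples F S)"
        using S FV[OF I] \<open>{x, y, z} \<union> S = I\<close>
        by (intro UN_I[of S] image_eqI[of _ _ "(x, y, z)"]) auto
    qed
    then have "card F \<le> card (\<Union>S\<in>?\<S>. (\<lambda>(x, y, z). {x, y, z} \<union> S) ` link_triples F S)"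
      by (rule card_mono[rotated]) (use fin finM in auto)
    also have "\<dots> \<le> (\<Sum>S\<in>?\<S>. card (link_triples F S))"
      by (rule order.trans[OF card_UN_le[OF fin]]) (intro sum_mono card_image_le finM)
    finally have "card F \<le> (\<Sum>S\<in>?\<S>. real (card (link_triples F S)))"
      by (simp flip: of_nat_sum)
    also have "\<dots> \<le> (\<Sum>S\<in>?\<S>. \<epsilon> * (card V)\<^sup>2)"
    proof (rule sum_mono)
      fix S assume "S \<in> ?\<S>"
      then have "ruzsa_szemeredi (link_triples F S)"
        using sep F V k by (intro ruzsa_szemeredi_link_triples[of k G]) (auto intro: finite_subset)
      then show "card (link_triples F S) \<le> \<epsilon> * (card V)\<^sup>2"
        using N V sub by blast
    qed
    also have "\<dots> = (card V choose (k - 3)) * (\<epsilon> * (card V)\<^sup>2)"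
      using V by (simp add: n_subsets)
    also have "\<dots> \<le> card V ^ (k - 3) * (\<epsilon> * (card V)\<^sup>2)"
    proof (rule mult_right_mono)
      have "card V choose (k - 3) \<le> card V ^ (k - 3)"
        by (rule order.trans[OF _ binomial_fact_pow]) simp
      then show "real (card V choose (k - 3)) \<le> card V ^ (k - 3)" by simp
    qed (use \<open>0 < \<epsilon>\<close> in simp)
    also have "\<dots> = \<epsilon> * card V ^ (k - 3 + 2)"
      by (simp add: power_add power2_eq_square)
    also have "k - 3 + 2 = k - 1" using k by simp
    finally show ?thesis .
  qed
  then show ?thesis by blast
qed

section \<open>Geodesics in configuration graphs\<close>

text \<open>Translates walks into relation powers, where splitting and concatenation are immediate.
  The equations for \<open>tail\<close> and \<open>head\<close> hold in every subgraph of a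
  \<open>with_proj\<close> graph.\<close>

lemma awalk_iff_relpow:
  assumes "wf_digraph C" and ht: "tail C = fst" "head C = snd" and u: "u \<in> verts C"
  shows "(\<exists>p. pre_digraph.awalk C u p v \<and> length p = m) \<longleftrightarrow> (u, v) \<in> arcs C ^^ m"
  using u
proof (induction m arbitrary: u)
  case 0
  then show ?case by (auto simp: pre_digraph.awalk_def pre_digraph.cas.simps)
next
  case (Suc m)
  have w: "w \<in> verts C" if "(u, w) \<in> arcs C" for w
    using wf_digraph.head_in_verts[OF assms(1) that] ht by simp
  have "(\<exists>p. pre_digraph.awalk C u p v \<and> length p = Suc m) \<longleftrightarrow>
    (\<exists>w. (u, w) \<in> arcs C \<and> (\<exists>p. pre_digraph.awalk C w p v \<and> length p = m))"
    (is "?L \<longleftrightarrow> ?R")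
  proof
    assume ?L
    then obtain e p where "pre_digraph.awalk C u (e # p) v" "length p = m"
      by (auto simp: length_Suc_conv)
    then show ?R
      using ht w[of "snd e"]
      by (intro exI[of _ "snd e"]) (auto simp: pre_digraph.awalk_def pre_digraph.cas.simps)
  next
    assume ?R
    then obtain w p where "(u, w) \<in> arcs C" "pre_digraph.awalk C w p v" "length p = m"
      by auto
    then show ?L
      using ht Suc.prems
      by (intro exI[of _ "(u, w) # p"]) (auto simp: pre_digraph.awalk_def pre_digraph.cas.simps)
  qed
  also have "\<dots> \<longleftrightarrow> (\<exists>w. (u, w) \<in> arcs C \<and> (w, v) \<in> arcs C ^^ m)"
    using Suc.IH w by blast
  also have "\<dots> \<longleftrightarrow> (u, v) \<in> arcs C ^^ Suc m"
    by (meson relpow_Suc_D2 relpow_Suc_I2)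
  finally show ?case .
qed

text \<open>Takes every third vertex of a shortest walk: two of them being equal, adjacent or joined
  through some \<open>W\<close> would give a shortcut.\<close>

lemma separated_family_of_geodesic:
  assumes fin: "finite (pverts G)" and C: "C \<in> pre_digraph.sccs (with_proj (configuration_graph k G))"
    and u: "u \<in> verts C" and v: "v \<in> verts C"
  shows "\<exists>F \<subseteq> {I. independent_set G I \<and> card I = k}. separated k G F \<and> graph_dist C u v \<le> 3 * card F"
proof -
  define V where "V = {I. independent_set G I \<and> card I = k}"
  let ?R = "configuration_graph k G"
  have V: "pverts ?R = V" and E: "(I, J) \<in> parcs ?R \<longleftrightarrow> I \<in> V \<and> J \<in> V \<and> card (I \<inter> J) = k - 1" for I J
    by (simp_all add: configuration_graph_def V_def Let_def)
  interpret R: pair_wf_digraph ?R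
    by unfold_locales (auto simp: V E)
  have Rwf: "wf_digraph (with_proj ?R)" ..
  have ind: "induced_subgraph C (with_proj ?R)" and sc: "strongly_connected C"
    using C by (auto simp: pre_digraph.sccs_def)
  have wfC: "wf_digraph C" and ht: "tail C = fst" "head C = snd" and CV: "verts C \<subseteq> V"
    using ind by (auto simp: induced_subgraph_def subgraph_def compatible_def V)
  have arcs: "(I, J) \<in> arcs C \<longleftrightarrow> I \<in> verts C \<and> J \<in> verts C \<and> card (I \<inter> J) = k - 1" for I J
    using ind CV by (auto simp: induced_subgraph_def E)
  \<comment> \<open>A component contains all neighbours of its vertices, so a common neighbour
    \<open>W\<close>, given merely as an independent set, lies in \<open>C\<close> and yields a walk
    there.\<close>
  have closed: "W \<in> verts C" if I: "I \<in> verts C" and W: "W \<in> V" and "card (I \<inter> W) = k - 1" for I W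
  proof -
    have "verts C \<in> pre_digraph.sccs_verts (with_proj ?R)"
      using C wf_digraph.sccs_verts_conv[OF Rwf] by blast
    moreover have "(I, W) \<in> parcs ?R" "(W, I) \<in> parcs ?R"
      using that CV by (auto simp: E Int_commute)
    then have "I \<rightarrow>\<^sup>*\<^bsub>with_proj ?R\<^esub> W" "W \<rightarrow>\<^sup>*\<^bsub>with_proj ?R\<^esub> I"
      by (auto intro!: wf_digraph.reachable_adjI[OF Rwf] simp: arcs_ends_conv)
    ultimately show ?thesis
      using I unfolding pre_digraph.sccs_verts_def by blast
  qed
  define d where "d = graph_dist C u v"
  have d_def': "d = (LEAST m. (u, v) \<in> arcs C ^^ m)"
    by (simp add: d_def graph_dist_def awalk_iff_relpow[OF wfC ht u])
  have "\<exists>m. (u, v) \<in> arcs C ^^ m"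
    using sc u v wf_digraph.reachable_awalk[OF wfC] awalk_iff_relpow[OF wfC ht u]
    unfolding strongly_connected_def by blast
  then have uv: "(u, v) \<in> arcs C ^^ d"
    unfolding d_def' by (rule LeastI_ex)
  have least: "d \<le> m" if "(u, v) \<in> arcs C ^^ m" for m
    unfolding d_def' using that by (rule Least_le)
  obtain f where f: "f 0 = u" "f d = v" "\<And>i. i < d \<Longrightarrow> (f i, f (Suc i)) \<in> arcs C"
    using uv by (auto simp: relpow_fun_conv)
  have seg: "(f i, f (i + l)) \<in> arcs C ^^ l" if "i + l \<le> d" for i l
    using that by (auto simp: relpow_fun_conv intro!: exI[of _ "\<lambda>t. f (i + t)"] f(3))
  have fC: "f i \<in> verts C" if "i \<le> d" for i
    using that f(3)[of i] v f(2) arcs by (cases "i = d") auto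
  \<comment> \<open>Replacing the part of the walk from \<open>f i\<close> to \<open>f j\<close> by
    \<open>l\<close> arcs cannot beat the distance \<open>d\<close>.\<close>
  have geodesic: "j \<le> i + l" if "i \<le> d" "j \<le> d" "(f i, f j) \<in> arcs C ^^ l" for i j l
  proof -
    have "(u, f i) \<in> arcs C ^^ i" "(f j, v) \<in> arcs C ^^ (d - j)"
      using seg[of 0 i] seg[of j "d - j"] that f by auto
    then have "(u, v) \<in> arcs C ^^ (i + (l + (d - j)))"
      using that(3) unfolding relpow_add by blast
    then show ?thesis using least that by fastforce
  qed
  \<comment> \<open>Position \<open>0\<close> counts as well, so there are
    \<open>d div 3 + 1\<close> members, enough for \<open>d \<le> 3 * card F\<close>.\<close>
  define F where "F = (\<lambda>i. f (3 * i)) ` {..d div 3}"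
  have apart: "f (3 * i) \<noteq> f (3 * j) \<and> card (f (3 * i) \<inter> f (3 * j)) \<noteq> k - 1 \<and>
     (\<forall>W\<in>V. card (f (3 * i) \<inter> W) = k - 1 \<longrightarrow> card (W \<inter> f (3 * j)) \<noteq> k - 1)"
    if ij: "i \<noteq> j" "i \<le> d div 3" "j \<le> d div 3" for i j
    using ij
  proof (induction i j rule: linorder_wlog)
    case (le i j)
    then have 3: "3 * i + 3 \<le> 3 * j" "3 * j \<le> d" "3 * i \<le> d" by auto
    have far: "(f (3 * i), f (3 * j)) \<notin> arcs C ^^ l" if "l < 3" for l
      using geodesic[of "3 * i" "3 * j" l] 3 that by auto
    have "f (3 * i) \<noteq> f (3 * j)" using far[of 0] by auto
    moreover have "card (f (3 * i) \<inter> f (3 * j)) \<noteq> k - 1"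
      using far[of 1] 3 fC arcs by auto
    moreover have "card (W \<inter> f (3 * j)) \<noteq> k - 1"
      if W: "W \<in> V" "card (f (3 * i) \<inter> W) = k - 1" for W
    proof
      assume W': "card (W \<inter> f (3 * j)) = k - 1"
      have "W \<in> verts C" using closed W fC 3 by blast
      then have "(f (3 * i), W) \<in> arcs C" "(W, f (3 * j)) \<in> arcs C"
        using W W' 3 fC arcs by auto
      then show False using far[of 2] by (auto simp: numeral_2_eq_2)
    qed
    ultimately show ?case by blast
  next
    case (sym i j)
    then show ?case by (metis Int_commute)
  qed
  have "inj_on (\<lambda>i. f (3 * i)) {..d div 3}"
    using apart by (auto simp: inj_on_def)
  then have "card F = Suc (d div 3)"
    by (simp add: F_def card_image)
  then have "d \<le> 3 * card F" by simp
  moreover have "F \<subseteq> V"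
    using fC CV by (fastforce simp: F_def)
  moreover have "separated k G F"
    unfolding separated_def
  proof (intro ballI impI)
    fix I J assume "I \<in> F" "J \<in> F" "I \<noteq> J"
    then obtain i j where "I = f (3 * i)" "J = f (3 * j)" "i \<noteq> j" "i \<le> d div 3" "j \<le> d div 3"
      by (auto simp: F_def)
    then show "card (I \<inter> J) \<noteq> k - 1 \<and> (\<forall>W. independent_set G W \<longrightarrow> card W = k \<longrightarrow>
        card (I \<inter> W) = k - 1 \<longrightarrow> card (W \<inter> J) \<noteq> k - 1)"
      using apart[of i j] by (simp add: V_def)
  qed
  ultimately show ?thesis
    unfolding d_def V_def by blast
qed

text \<open>The maxima over graphs, components and pairs of vertices are over finite nonempty sets
  and so are attained; the first alternative comes from the \<open>0\<close> inserted by
  convention.\<close>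

lemma max_configuration_diameter_attained:
  obtains "max_configuration_diameter n k = 0"
  | G :: "nat pair_pre_digraph" and C u v where "pverts G = {..<n}"
    "C \<in> pre_digraph.sccs (with_proj (configuration_graph k G))" "u \<in> verts C" "v \<in> verts C"
    "max_configuration_diameter n k = graph_dist C u v"
proof -
  let ?\<G> = "{G :: nat pair_pre_digraph. pair_graph G \<and> pverts G = {..<n}}"
  let ?D = "\<lambda>G. max_component_diameter (with_proj (configuration_graph k G))"
  have "?\<G> \<subseteq> (\<lambda>E. \<lparr>pverts = {..<n}, parcs = E\<rparr>) ` Pow ({..<n} \<times> {..<n})"
  proof
    fix G assume "G \<in> ?\<G>"
    then interpret pair_graph G by simp
    have "parcs G \<subseteq> {..<n} \<times> {..<n}"
      using \<open>G \<in> ?\<G>\<close> in_arcsD1 in_arcsD2 by auto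
    then show "G \<in> (\<lambda>E. \<lparr>pverts = {..<n}, parcs = E\<rparr>) ` Pow ({..<n} \<times> {..<n})"
      using \<open>G \<in> ?\<G>\<close> by (intro image_eqI[of _ _ "parcs G"]) auto
  qed
  then have "finite ?\<G>" by (rule finite_subset) simp
  moreover have "pair_graph \<lparr>pverts = {..<n}, parcs = {}\<rparr>"
    by unfold_locales (auto simp: symmetric_def)
  then have "?\<G> \<noteq> {}" by force
  moreover have "max_configuration_diameter n k = Max (?D ` ?\<G>)"
    unfolding max_configuration_diameter_def by (rule arg_cong[of _ _ Max]) auto
  ultimately have "max_configuration_diameter n k \<in> ?D ` ?\<G>"
    using Max_in[of "?D ` ?\<G>"] by simp
  then obtain G :: "nat pair_pre_digraph" where G: "pverts G = {..<n}" "max_configuration_diameter n k = ?D G"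
    by auto
  let ?R = "configuration_graph k G"
  have fin: "finite (pverts ?R)"
    by (rule finite_subset[of _ "Pow {..<n}"])
      (auto simp: configuration_graph_def Let_def independent_set_def G)
  have sub: "parcs ?R \<subseteq> pverts ?R \<times> pverts ?R"
    by (auto simp: configuration_graph_def Let_def)
  interpret R: pair_fin_digraph ?R
    by unfold_locales (use fin sub in \<open>auto intro: finite_subset\<close>)
  have Rwf: "fin_digraph (with_proj ?R)"
    by unfold_locales
  \<comment> \<open>A component is determined by its vertex set, so there are finitely many.\<close>
  have "finite (verts ` pre_digraph.sccs (with_proj ?R))"
    using fin_digraph.finite_sccs_verts[OF Rwf] wf_digraph.sccs_verts_conv[OF fin_digraph.axioms(1)[OF Rwf]] by simp
  then have "finite (pre_digraph.sccs (with_proj ?R))"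
    using finite_imageD wf_digraph.inj_on_verts_sccs[OF fin_digraph.axioms(1)[OF Rwf]] by blast
  then have "?D G \<in> insert 0 (graph_diameter ` pre_digraph.sccs (with_proj ?R))"
    unfolding max_component_diameter_def by (intro Max_in) auto
  then consider "?D G = 0" | C where "C \<in> pre_digraph.sccs (with_proj ?R)" "?D G = graph_diameter C"
    by (elim insertE imageE)
  then show ?thesis
  proof cases
    case 1
    then show ?thesis using that(1) G by simp
  next
    case 2
    then have ne: "verts C \<noteq> {}" and "verts C \<subseteq> pverts ?R"
      by (auto simp: pre_digraph.sccs_def strongly_connected_def induced_subgraph_def subgraph_def)
    then have "finite (verts C)" using fin finite_subset by blast
    moreover have "{graph_dist C u v | u v. u \<in> verts C \<and> v \<in> verts C} =
      (\<lambda>(u, v). graph_dist C u v) ` (verts C \<times> verts C)"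
      by auto
    ultimately have "graph_diameter C \<in> (\<lambda>(u, v). graph_dist C u v) ` (verts C \<times> verts C)"
      using ne by (simp only: graph_diameter_def) (intro Max_in, auto)
    then obtain u v where "u \<in> verts C" "v \<in> verts C" "graph_diameter C = graph_dist C u v"
      by auto
    then show ?thesis using that(2)[OF G(1) 2(1)] G(2) 2(2) by simp
  qed
qed

theorem mainTheorem1:
  fixes k :: nat
  assumes "k \<ge> 3"
  shows "(\<lambda>n. real (max_configuration_diameter n k)) \<in> o(\<lambda>n. real n ^ (k - 1))"
proof (rule landau_o.smallI)
  fix c :: real assume "0 < c"
  \<comment> \<open>Dividing by 3 pays for keeping only every third vertex of the geodesic.\<close>
  then have "0 < c / 3" by simp
  from card_separated_le[OF assms this, where 'a = nat] obtain N where N: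
    "\<forall>(V :: nat set) G F. finite V \<longrightarrow> N \<le> card V \<longrightarrow> pverts G = V \<longrightarrow>
      F \<subseteq> {I. independent_set G I \<and> card I = k} \<longrightarrow> separated k G F \<longrightarrow> card F \<le> c / 3 * card V ^ (k - 1)" ..
  have "max_configuration_diameter n k \<le> c * real n ^ (k - 1)" if n: "N \<le> n" for n
  proof (rule max_configuration_diameter_attained[of n k])
    assume "max_configuration_diameter n k = 0"
    then show ?thesis using \<open>0 < c\<close> by simp
  next
    fix G :: "nat pair_pre_digraph" and C u v
    assume G: "pverts G = {..<n}" "C \<in> pre_digraph.sccs (with_proj (configuration_graph k G))"
      "u \<in> verts C" "v \<in> verts C" and D: "max_configuration_diameter n k = graph_dist C u v"
    have "finite (pverts G)" using G by simp
    from separated_family_of_geodesic[OF this G(2-4)] obtain F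
      where "F \<subseteq> {I. independent_set G I \<and> card I = k}" "separated k G F" "graph_dist C u v \<le> 3 * card F"
      by blast
    then show ?thesis
      using N[rule_format, of "{..<n}" G F] n G D by simp
  qed
  then show "\<forall>\<^sub>F n in at_top. norm (real (max_configuration_diameter n k)) \<le> c * norm (real n ^ (k - 1))"
    unfolding eventually_at_top_linorder by (intro exI[of _ N]) simp
qed

end
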